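(* Let $\sigma>0$ with $\sigma\notin2\mathbb Z$, and let $\theta(\sigma):=\sigma$ if $0<\sigma<2$ and $\theta(\sigma):=4/\sigma$ if $\sigma>2$. For $y=(u,v)^\top\in(\mathrm L^2(\mathbb T))^2$ define $$\widetilde{\mathsf H}_1(\sigma)[y]:=2\sum_{\xi\in\mathbb Z\setminus\{0\}}\mathsf H_1\big(\xi,\overline\delta(\xi,\sigma)\big)[\hat y(\xi)],\qquad\overline\delta(\xi,\sigma):=\frac{\theta(\sigma)(1+\xi^2)}{2\xi^2},$$ and $$\widetilde{\mathsf H}_2(\sigma)[y]:=\sum_{\xi\in\mathbb Z\setminus\{0\}}\|\hat y(\xi)\|^2_{\overline P(\xi,\theta(\sigma))},$$ with $\mathsf H_1(\xi,\delta)$ and $\overline P(\xi,\theta)$ as given in the context. Then, for all $y\in(\mathrm L^2(\mathbb T))^2$, $$\widetilde{\mathsf H}_1(\sigma)[y]=\widetilde{\mathsf H}_2(\sigma)[y].$$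
   Context: $\mathbb T$ is the one-dimensional torus of length $2\pi$ and $\hat y(\xi)=(\hat u(\xi),\hat v(\xi))^\top\in\mathbb C^2$, $\xi\in\mathbb Z$, are the Fourier coefficients of $y$. For $\xi\neq0$, $\delta>0$ and $z\in\mathbb C^2$, $$\mathsf H_1(\xi,\delta)[z]:=\frac12\|z\|^2+\delta\,\mathrm{Re}\big(z^*\mathsf A(\xi)z\big),\qquad \mathsf A(\xi):=\big(\mathrm{Id}+(\mathsf T(\xi)\Pi)^*\mathsf T(\xi)\Pi\big)^{-1}(\mathsf T(\xi)\Pi)^*=\begin{pmatrix}0&-\frac{i\xi}{1+\xi^2}\\0&0\end{pmatrix},$$ where $\mathsf T(\xi)=\begin{pmatrix}0&i\xi\\i\xi&0\end{pmatrix}$ and $\Pi=\begin{pmatrix}1&0\\0&0\end{pmatrix}$. For a positive definite Hermitian matrix $P$, $\|z\|_P^2:=\langle z,Pz\rangle=z^*Pz$, and $$\overline P(\xi,\theta):=\begin{pmatrix}1&-\frac{i\theta}{2\xi}\\ \frac{i\theta}{2\xi}&1\end{pmatrix}.$$ *)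

theory Defs
  imports "HOL-Analysis.Analysis"
begin

text \<open>Representatives of elements of \<open>L\<^sup>2\<close> of the torus \<open>\<real> / 2\<pi>\<int>\<close>: complex-valued
  \<open>2\<pi>\<close>-periodic functions on the line, square integrable over one period.\<close>

definition L2_torus :: "(real \<Rightarrow> complex) set" where
  "L2_torus = {f. f \<in> borel_measurable lebesgue \<and> (\<forall>x. f (x + 2 * pi) = f x) \<and>
     set_integrable lebesgue {0..2 * pi} (\<lambda>x. (cmod (f x))\<^sup>2)}"

definition fourier_coeff :: "(real \<Rightarrow> complex) \<Rightarrow> int \<Rightarrow> complex" where
  "fourier_coeff f \<xi> = 1 / complex_of_real (2 * pi) *
     (LINT x:{0..2 * pi}|lebesgue. f x * exp (- \<i> * of_int \<xi> * complex_of_real x))"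

definition fourier_vec :: "(real \<Rightarrow> complex^2) \<Rightarrow> int \<Rightarrow> complex^2" where
  "fourier_vec y \<xi> = (\<chi> j. fourier_coeff (\<lambda>x. y x $ j) \<xi>)"

text \<open>The form \<open>z\<^sup>* w\<close>, antilinear in the first argument, and the conjugate transpose.\<close>

definition cinner :: "complex^'n \<Rightarrow> complex^'n \<Rightarrow> complex" where
  "cinner z w = (\<Sum>j\<in>UNIV. cnj (z $ j) * w $ j)"

definition adjoint_mat :: "complex^'n^'m \<Rightarrow> complex^'m^'n" where
  "adjoint_mat M = (\<chi> i j. cnj (M $ j $ i))"

definition hermitian :: "complex^'n^'n \<Rightarrow> bool" where
  "hermitian P \<longleftrightarrow> adjoint_mat P = P"

definition pos_def_hermitian :: "complex^'n^'n \<Rightarrow> bool" where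
  "pos_def_hermitian P \<longleftrightarrow> hermitian P \<and> (\<forall>z. z \<noteq> 0 \<longrightarrow> Re (cinner z (P *v z)) > 0)"

text \<open>The real part only converts the type: \<open>z\<^sup>* P z\<close> is real for Hermitian \<open>P\<close>, see
  \<open>wnorm_sq_hermitian\<close> below.\<close>

definition wnorm_sq :: "complex^'n^'n \<Rightarrow> complex^'n \<Rightarrow> real" where
  "wnorm_sq P z = Re (cinner z (P *v z))"

definition T_mat :: "int \<Rightarrow> complex^2^2" where
  "T_mat \<xi> = vector [vector [0, \<i> * of_int \<xi>], vector [\<i> * of_int \<xi>, 0]]"

definition Pi_mat :: "complex^2^2" where
  "Pi_mat = vector [vector [1, 0], vector [0, 0]]"

definition A_mat :: "int \<Rightarrow> complex^2^2" where
  "A_mat \<xi> = matrix_inv (mat 1 + adjoint_mat (T_mat \<xi> ** Pi_mat) ** (T_mat \<xi> ** Pi_mat))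
     ** adjoint_mat (T_mat \<xi> ** Pi_mat)"

definition H1 :: "int \<Rightarrow> real \<Rightarrow> complex^2 \<Rightarrow> real" where
  "H1 \<xi> \<delta> z = 1 / 2 * (norm z)\<^sup>2 + \<delta> * Re (cinner z (A_mat \<xi> *v z))"

definition P_bar :: "int \<Rightarrow> real \<Rightarrow> complex^2^2" where
  "P_bar \<xi> \<theta> = vector
     [vector [1, - (\<i> * of_real \<theta> / (2 * of_int \<xi>))],
      vector [\<i> * of_real \<theta> / (2 * of_int \<xi>), 1]]"

definition theta :: "real \<Rightarrow> real" where
  "theta \<sigma> = (if \<sigma> < 2 then \<sigma> else 4 / \<sigma>)"

definition delta_bar :: "int \<Rightarrow> real \<Rightarrow> real" where
  "delta_bar \<xi> \<sigma> = theta \<sigma> * (1 + (of_int \<xi>)\<^sup>2) / (2 * (of_int \<xi>)\<^sup>2)"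

definition H1_tilde :: "real \<Rightarrow> (real \<Rightarrow> complex^2) \<Rightarrow> real" where
  "H1_tilde \<sigma> y = 2 * (\<Sum>\<^sub>\<infinity>\<xi>\<in>UNIV - {0}. H1 \<xi> (delta_bar \<xi> \<sigma>) (fourier_vec y \<xi>))"

definition H2_tilde :: "real \<Rightarrow> (real \<Rightarrow> complex^2) \<Rightarrow> real" where
  "H2_tilde \<sigma> y = (\<Sum>\<^sub>\<infinity>\<xi>\<in>UNIV - {0}. wnorm_sq (P_bar \<xi> (theta \<sigma>)) (fourier_vec y \<xi>))"

lemma wnorm_sq_hermitian:
  assumes "hermitian P"
  shows "complex_of_real (wnorm_sq P z) = cinner z (P *v z)"
proof -
  have P: "cnj (P $ i $ j) = P $ j $ i" for i j
    using assms unfolding hermitian_def adjoint_mat_def by (metis vec_lambda_beta)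
  have "cnj (cinner z (P *v z)) = (\<Sum>i\<in>UNIV. \<Sum>j\<in>UNIV. cnj (z $ j) * (P $ j $ i * z $ i))"
    by (simp add: cinner_def matrix_vector_mult_def P sum_distrib_left algebra_simps)
  also have "\<dots> = cinner z (P *v z)"
    by (subst sum.swap) (simp add: cinner_def matrix_vector_mult_def sum_distrib_left)
  finally show ?thesis
    unfolding wnorm_sq_def by (metis Reals_cnj_iff of_real_Re)
qed

lemma theta_bounds:
  assumes "\<sigma> > 0" "\<sigma> \<noteq> 2"
  shows "0 < theta \<sigma>" "theta \<sigma> < 2"
  using assms by (auto simp: theta_def field_simps)

lemma pos_def_P_bar:
  assumes "\<xi> \<noteq> 0" "0 < \<theta>" "\<theta> < 2"
  shows "pos_def_hermitian (P_bar \<xi> \<theta>)"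
proof -
  define t where "t = \<theta> / (2 * real_of_int \<xi>)"
  have "\<bar>real_of_int \<xi>\<bar> \<ge> 1" using assms(1) by linarith
  hence t: "\<bar>t\<bar> < 1" using assms by (simp add: t_def field_simps)
  have P: "P_bar \<xi> \<theta> = vector [vector [1, - (\<i> * of_real t)], vector [\<i> * of_real t, 1]]"
    by (simp add: P_bar_def t_def)
  have h: "hermitian (P_bar \<xi> \<theta>)"
    by (simp add: P hermitian_def adjoint_mat_def vec_eq_iff forall_2)
  moreover have "Re (cinner z (P_bar \<xi> \<theta> *v z)) > 0" if "z \<noteq> 0" for z
  proof -
    obtain a b c d where z: "z $ 1 = Complex a b" "z $ 2 = Complex c d"
      by (metis complex.exhaust)
    have nz: "a \<noteq> 0 \<or> b \<noteq> 0 \<or> c \<noteq> 0 \<or> d \<noteq> 0"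
      using that z by (auto simp: vec_eq_iff forall_2 Complex_eq_0)
    have eq: "Re (cinner z (P_bar \<xi> \<theta> *v z)) = a\<^sup>2 + b\<^sup>2 + c\<^sup>2 + d\<^sup>2 + 2 * t * (a * d - b * c)"
      by (simp add: P cinner_def matrix_vector_mult_def sum_2 z algebra_simps power2_eq_square)
    also have "\<dots> = (a + t * d)\<^sup>2 + (b - t * c)\<^sup>2 + (1 - t\<^sup>2) * (c\<^sup>2 + d\<^sup>2)"
      by (simp add: algebra_simps power2_eq_square)
    also have "\<dots> > 0"
    proof (cases "c = 0 \<and> d = 0")
      case True
      with nz show ?thesis by (auto simp: sum_power2_gt_zero_iff)
    next
      case False
      have "1 - t\<^sup>2 > 0" using t by (simp add: abs_square_less_1)
      with False have "(1 - t\<^sup>2) * (c\<^sup>2 + d\<^sup>2) > 0" by (simp add: sum_power2_gt_zero_iff)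
      thus ?thesis by (simp add: add_nonneg_pos)
    qed
    finally show ?thesis .
  qed
  ultimately show ?thesis by (simp add: pos_def_hermitian_def)
qed

lemma A_mat_explicit:
  "A_mat \<xi> = vector [vector [0, - (\<i> * of_int \<xi> / (1 + (of_int \<xi>)\<^sup>2))], vector [0, 0]]"
proof -
  let ?x = "complex_of_int \<xi>"
  define B :: "complex^2^2" where "B = vector [vector [1 + ?x\<^sup>2, 0], vector [0, 1]]"
  define C :: "complex^2^2" where "C = vector [vector [1 / (1 + ?x\<^sup>2), 0], vector [0, 1]]"
  have "1 + (real_of_int \<xi>)\<^sup>2 \<noteq> 0"
    by (metis add_nonneg_eq_0_iff one_neq_zero zero_le_one zero_le_power2)
  hence "complex_of_real (1 + (real_of_int \<xi>)\<^sup>2) \<noteq> 0"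
    by (metis of_real_eq_0_iff)
  hence nz: "1 + ?x\<^sup>2 \<noteq> 0" by simp
  have M: "mat 1 + adjoint_mat (T_mat \<xi> ** Pi_mat) ** (T_mat \<xi> ** Pi_mat) = B"
    by (simp add: B_def T_mat_def Pi_mat_def adjoint_mat_def matrix_matrix_mult_def mat_def
        sum_2 vec_eq_iff forall_2 power2_eq_square mult.assoc mult.left_commute)
  have BC: "B ** C = mat 1" "C ** B = mat 1"
    using nz by (simp_all add: B_def C_def matrix_matrix_mult_def mat_def sum_2 vec_eq_iff forall_2)
  have "B ** matrix_inv B = mat 1 \<and> matrix_inv B ** B = mat 1"
    unfolding matrix_inv_def
    by (rule someI[where P = "\<lambda>X. B ** X = mat 1 \<and> X ** B = mat 1", OF conjI[OF BC]])
  hence inv: "B ** matrix_inv B = mat 1" ..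
  have "matrix_inv B = (C ** B) ** matrix_inv B" by (simp only: BC matrix_mul_lid)
  also have "\<dots> = C" by (simp only: matrix_mul_assoc[symmetric] inv matrix_mul_rid)
  finally have Binv: "matrix_inv B = C" .
  show ?thesis
    by (simp only: A_mat_def M Binv)
      (simp add: C_def T_mat_def Pi_mat_def adjoint_mat_def matrix_matrix_mult_def
        sum_2 vec_eq_iff forall_2)
qed

end

theory Submission imports Defs begin

text \<open>Both functionals are sums over \<open>\<xi> \<noteq> 0\<close> of quadratic forms in \<open>z = \<^term>\<open>fourier_vec y \<xi>\<close>\<close>,
  and the forms agree frequency by frequency, up to the factor 2 in front of the first sum. Only
  the upper right entry \<open>- \<i> \<xi> / (1 + \<xi>\<^sup>2)\<close> of \<open>A = \<close>\<^term>\<open>A_mat \<xi>\<close> is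
  nonzero, and the factor \<open>1 + \<xi>\<^sup>2\<close> in \<open>\<delta> = \<close>\<^term>\<open>delta_bar \<xi> \<sigma>\<close>
  cancels its denominator. As \<open>Re (z\<^sup>* A z)\<close> sees only the Hermitian part of \<open>A\<close>, the matrix of
  \<open>2 H1\<close> is \<open>Id + \<delta> (A + A\<^sup>*)\<close>, which is \<^term>\<open>P_bar \<xi> (theta \<sigma>)\<close>
  (\<open>wnorm_sq_P_bar_eq_H1\<close>).

  What takes work is that the sums converge. Both terms are at most a constant times
  \<open>\<parallel>z\<parallel>\<^sup>2\<close>, uniformly in \<open>\<xi>\<close>, so it suffices that the Fourier coefficients of
  a square integrable function are square summable. This is Bessel's inequality
  (\<open>bessel_inequality\<close>), applied to the characters \<open>x \<mapsto> exp (\<i> k x)\<close>, which are orthogonal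
  on one period.\<close>

section \<open>Bessel's inequality for orthogonal families\<close>

lemma integrable_mult_cnj_square_integrable:
  fixes f g :: "'a \<Rightarrow> complex"
  assumes [measurable]: "f \<in> borel_measurable M" "g \<in> borel_measurable M"
    and f2: "integrable M (\<lambda>x. (cmod (f x))\<^sup>2)" and g2: "integrable M (\<lambda>x. (cmod (g x))\<^sup>2)"
  shows "integrable M (\<lambda>x. f x * cnj (g x))"
proof (rule Bochner_Integration.integrable_bound)
  show "integrable M (\<lambda>x. (cmod (f x))\<^sup>2 + (cmod (g x))\<^sup>2)"
    using f2 g2 by simp
  have "cnj \<in> borel_measurable borel"
    by (intro borel_measurable_continuous_onI continuous_intros)
  then have [measurable]: "(\<lambda>x. cnj (g x)) \<in> borel_measurable M"
    by (rule measurable_compose[rotated]) fact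
  show "(\<lambda>x. f x * cnj (g x)) \<in> borel_measurable M"
    by measurable
  have "a * b \<le> a\<^sup>2 + b\<^sup>2" if "a \<ge> 0" "b \<ge> 0" for a b :: real
    using sum_squares_bound[of a b] mult_nonneg_nonneg[OF that] by linarith
  then show "AE x in M. norm (f x * cnj (g x)) \<le> norm ((cmod (f x))\<^sup>2 + (cmod (g x))\<^sup>2)"
    by (simp add: norm_mult)
qed

text \<open>The integral of \<open>\<bar>f - S\<bar>\<^sup>2\<close> is nonnegative for every combination \<open>S\<close> of the \<open>e k\<close>.
  If \<open>S\<close> is the orthogonal projection of \<open>f\<close>, the cross term of the expanded square is minus
  twice the integral of \<open>\<bar>S\<bar>\<^sup>2\<close>, and the inequality is what remains.\<close>

lemma bessel_inequality:
  fixes f :: "'a \<Rightarrow> complex" and e :: "'i \<Rightarrow> 'a \<Rightarrow> complex"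
  assumes f: "f \<in> borel_measurable M" "integrable M (\<lambda>x. (cmod (f x))\<^sup>2)"
    and e: "\<And>k. k \<in> F \<Longrightarrow> e k \<in> borel_measurable M"
      "\<And>k. k \<in> F \<Longrightarrow> integrable M (\<lambda>x. (cmod (e k x))\<^sup>2)"
    and orth: "\<And>k l. k \<in> F \<Longrightarrow> l \<in> F \<Longrightarrow>
      (LINT x|M. e k x * cnj (e l x)) = (if k = l then complex_of_real c else 0)"
    and c: "c > 0" and F: "finite F"
  shows "(\<Sum>k\<in>F. (cmod (LINT x|M. f x * cnj (e k x)))\<^sup>2) \<le> c * (LINT x|M. (cmod (f x))\<^sup>2)"
proof -
  define b where "b k = (LINT x|M. f x * cnj (e k x))" for k
  define a where "a k = b k / complex_of_real c" for k
  define S where "S x = (\<Sum>k\<in>F. a k * e k x)" for x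
  have fe: "integrable M (\<lambda>x. f x * cnj (e k x))" if "k \<in> F" for k
    using that f e by (intro integrable_mult_cnj_square_integrable) auto
  have ee: "integrable M (\<lambda>x. e k x * cnj (e l x))" if "k \<in> F" "l \<in> F" for k l
    using that e by (intro integrable_mult_cnj_square_integrable) auto
  have fS_eq: "f x * cnj (S x) = (\<Sum>k\<in>F. cnj (a k) * (f x * cnj (e k x)))" for x
    by (simp add: S_def sum_distrib_left algebra_simps)
  have SS_eq: "S x * cnj (S x) = (\<Sum>k\<in>F. \<Sum>l\<in>F. a k * cnj (a l) * (e k x * cnj (e l x)))" for x
    by (simp add: S_def sum_product algebra_simps)
  have fS: "integrable M (\<lambda>x. f x * cnj (S x))"
    unfolding fS_eq by (intro Bochner_Integration.integrable_sum integrable_mult_right fe)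
  have SS: "integrable M (\<lambda>x. S x * cnj (S x))"
    unfolding SS_eq by (intro Bochner_Integration.integrable_sum integrable_mult_right ee)
  have int_fS: "(LINT x|M. f x * cnj (S x)) = of_real ((\<Sum>k\<in>F. (cmod (b k))\<^sup>2) / c)"
  proof -
    have "(LINT x|M. f x * cnj (S x)) = (\<Sum>k\<in>F. cnj (a k) * b k)"
      unfolding fS_eq b_def by (simp add: Bochner_Integration.integral_sum fe)
    also have "\<dots> = (\<Sum>k\<in>F. of_real ((cmod (b k))\<^sup>2) / of_real c)"
      by (intro sum.cong refl) (simp add: a_def complex_norm_square mult.commute del: of_real_power)
    finally show ?thesis
      by (simp add: sum_divide_distrib)
  qed
  have int_SS: "(LINT x|M. S x * cnj (S x)) = of_real ((\<Sum>k\<in>F. (cmod (b k))\<^sup>2) / c)"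
  proof -
    have "(LINT x|M. S x * cnj (S x)) =
        (\<Sum>k\<in>F. \<Sum>l\<in>F. a k * cnj (a l) * (LINT x|M. e k x * cnj (e l x)))"
      unfolding SS_eq by (simp add: Bochner_Integration.integral_sum ee)
    also have "\<dots> = (\<Sum>k\<in>F. a k * cnj (a k) * of_real c)"
    proof (rule sum.cong[OF refl])
      fix k assume k: "k \<in> F"
      have "(\<Sum>l\<in>F. a k * cnj (a l) * (LINT x|M. e k x * cnj (e l x))) =
          (\<Sum>l\<in>F. if l = k then a k * cnj (a k) * of_real c else 0)"
        by (intro sum.cong refl) (auto simp: orth k)
      then show "(\<Sum>l\<in>F. a k * cnj (a l) * (LINT x|M. e k x * cnj (e l x))) =
          a k * cnj (a k) * of_real c"
        using F k by simp
    qed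
    also have "\<dots> = (\<Sum>k\<in>F. of_real ((cmod (b k))\<^sup>2) / of_real c)"
      using c by (intro sum.cong refl) (simp add: a_def complex_norm_square del: of_real_power)
    finally show ?thesis
      by (simp add: sum_divide_distrib)
  qed
  have expand: "(cmod (f x - S x))\<^sup>2 =
      (cmod (f x))\<^sup>2 - 2 * Re (f x * cnj (S x)) + Re (S x * cnj (S x))" for x
    by (simp only: cmod_power2) (simp add: power2_eq_square algebra_simps)
  have "0 \<le> (LINT x|M. (cmod (f x - S x))\<^sup>2)"
    by simp
  also have "\<dots> = (LINT x|M. (cmod (f x))\<^sup>2) - 2 * Re (LINT x|M. f x * cnj (S x))
      + Re (LINT x|M. S x * cnj (S x))"
    unfolding expand using f fS SS by (simp del: complex_cnj_cancel_iff times_complex.sel)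
  also have "\<dots> = (LINT x|M. (cmod (f x))\<^sup>2) - (\<Sum>k\<in>F. (cmod (b k))\<^sup>2) / c"
    unfolding int_fS int_SS by simp
  finally show ?thesis
    using c by (simp add: b_def field_simps)
qed

section \<open>Square summability of Fourier coefficients\<close>

lemma integral_character_period:
  "(LINT x:{0..2 * pi}|lebesgue. exp (\<i> * of_int n * complex_of_real x)) =
    (if n = 0 then complex_of_real (2 * pi) else 0)"
proof -
  let ?g = "\<lambda>x::real. exp (\<i> * of_int n * complex_of_real x)"
  have "(?g has_integral (if n = 0 then complex_of_real (2 * pi) else 0)) {0..2 * pi}"
  proof (cases "n = 0")
    case True
    then show ?thesis
      using has_integral_const_real[of "1::complex" 0 "2 * pi"]
      by (simp add: scaleR_conv_of_real)
  next
    case False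
    let ?G = "\<lambda>x::real. exp (\<i> * of_int n * complex_of_real x) / (\<i> * of_int n)"
    have "(?G has_vector_derivative ?g x) (at x within {0..2 * pi})" for x
      by (rule has_vector_derivative_real_field[where
            f = "\<lambda>w. exp (\<i> * of_int n * w) / (\<i> * of_int n)"])
        (use False in \<open>auto intro!: derivative_eq_intros\<close>)
    then have "(?g has_integral (?G (2 * pi) - ?G 0)) {0..2 * pi}"
      by (intro fundamental_theorem_of_calculus) auto
    moreover have "exp (\<i> * of_int n * complex_of_real (2 * pi)) = 1"
      by (auto simp: exp_eq_1)
    ultimately show ?thesis
      using False by simp
  qed
  moreover have "set_integrable lebesgue {0..2 * pi} ?g"
    by (intro absolutely_integrable_continuous_real continuous_intros)
  ultimately show ?thesis
    by (simp add: set_lebesgue_integral_eq_integral(2) integral_unique)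
qed

lemma fourier_coeff_bessel:
  assumes f: "f \<in> L2_torus" and F: "finite F"
  shows "(\<Sum>k\<in>F. (cmod (fourier_coeff f k))\<^sup>2) \<le>
    (LINT x:{0..2 * pi}|lebesgue. (cmod (f x))\<^sup>2) / (2 * pi)"
proof -
  \<comment> \<open>One period as a measure space of its own, on which the characters are integrable.\<close>
  define M where "M = restrict_space (lebesgue :: real measure) {0..2 * pi}"
  define e where "e k x = exp (\<i> * of_int k * complex_of_real x)" for k :: int and x :: real
  have to_set: "(LINT x|M. g x) = (LINT x:{0..2 * pi}|lebesgue. g x)"
    for g :: "real \<Rightarrow> 'a :: {banach, second_countable_topology}"
    by (simp add: M_def integral_restrict_space set_lebesgue_integral_def)
  have to_set_integrable: "integrable M g \<longleftrightarrow> set_integrable lebesgue {0..2 * pi} g"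
    for g :: "real \<Rightarrow> 'a :: {banach, second_countable_topology}"
    by (simp add: M_def integrable_restrict_space set_integrable_def)
  have cnj_e: "cnj (e k x) = exp (- \<i> * of_int k * complex_of_real x)" for k x
    by (simp add: e_def exp_cnj)
  have e_int: "integrable M (e k)" for k
    unfolding to_set_integrable e_def
    by (intro absolutely_integrable_continuous_real continuous_intros)
  have e_orth: "(LINT x|M. e k x * cnj (e l x)) =
      (if k = l then complex_of_real (2 * pi) else 0)" for k l
  proof -
    have "e k x * cnj (e l x) = exp (\<i> * of_int (k - l) * complex_of_real x)" for x
      unfolding cnj_e unfolding e_def by (simp add: exp_add[symmetric] algebra_simps)
    then show ?thesis
      using integral_character_period[of "k - l"] by (simp add: to_set)
  qed
  have norm_e: "cmod (e k x) = 1" for k x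
    by (simp add: e_def norm_exp_eq_Re)
  have "integrable M (\<lambda>x. (cmod (e k x))\<^sup>2)" for k
    unfolding norm_e to_set_integrable
    by (intro absolutely_integrable_continuous_real continuous_intros)
  moreover have "f \<in> borel_measurable M" "integrable M (\<lambda>x. (cmod (f x))\<^sup>2)"
    using f unfolding to_set_integrable
    by (auto simp: L2_torus_def M_def intro: measurable_restrict_space1)
  ultimately have "(\<Sum>k\<in>F. (cmod (LINT x|M. f x * cnj (e k x)))\<^sup>2) \<le>
      2 * pi * (LINT x|M. (cmod (f x))\<^sup>2)"
    using F e_int e_orth by (intro bessel_inequality) auto
  moreover have "(cmod (fourier_coeff f k))\<^sup>2 =
      (cmod (LINT x|M. f x * cnj (e k x)))\<^sup>2 / (2 * pi)\<^sup>2" for k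
    by (simp add: fourier_coeff_def to_set cnj_e norm_divide norm_mult power_divide
        power_mult_distrib)
  ultimately have "(\<Sum>k\<in>F. (cmod (fourier_coeff f k))\<^sup>2) \<le>
      2 * pi * (LINT x|M. (cmod (f x))\<^sup>2) / (2 * pi)\<^sup>2"
    by (simp only: sum_divide_distrib[symmetric]) (rule divide_right_mono, auto)
  then show ?thesis
    by (simp add: to_set power2_eq_square)
qed

lemma fourier_coeff_square_summable:
  assumes "f \<in> L2_torus"
  shows "(\<lambda>k. (cmod (fourier_coeff f k))\<^sup>2) summable_on A"
  using fourier_coeff_bessel[OF assms]
  by (intro nonneg_bdd_above_summable_on bdd_aboveI2) auto

lemma norm_sq_complex_vec2: "(norm z)\<^sup>2 = (cmod (z $ 1))\<^sup>2 + (cmod (z $ 2))\<^sup>2"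
  for z :: "complex^2"
  by (simp add: norm_vec_def L2_set_def sum_2)

lemma fourier_vec_square_summable:
  assumes "\<forall>j. (\<lambda>x. y x $ j) \<in> L2_torus"
  shows "(\<lambda>\<xi>. (norm (fourier_vec y \<xi>))\<^sup>2) summable_on A"
  using assms by (simp add: norm_sq_complex_vec2 fourier_vec_def summable_on_add
      fourier_coeff_square_summable)

section \<open>Comparison of the quadratic forms\<close>

lemma wnorm_sq_P_bar:
  "wnorm_sq (P_bar \<xi> \<theta>) z = (norm z)\<^sup>2 + \<theta> / of_int \<xi> * Im (cnj (z $ 1) * z $ 2)"
proof -
  define t where "t = \<theta> / (2 * real_of_int \<xi>)"
  have P: "P_bar \<xi> \<theta> = vector [vector [1, - (\<i> * of_real t)], vector [\<i> * of_real t, 1]]"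
    by (simp add: P_bar_def t_def)
  have "wnorm_sq (P_bar \<xi> \<theta>) z = (norm z)\<^sup>2 + 2 * t * Im (cnj (z $ 1) * z $ 2)"
    unfolding norm_sq_complex_vec2 cmod_power2
    by (simp add: P wnorm_sq_def cinner_def matrix_vector_mult_def sum_2 power2_eq_square
        algebra_simps)
  then show ?thesis
    by (simp add: t_def)
qed

lemma H1_eq:
  "H1 \<xi> \<delta> z = 1 / 2 * (norm z)\<^sup>2 +
    \<delta> * (of_int \<xi> / (1 + (of_int \<xi>)\<^sup>2)) * Im (cnj (z $ 1) * z $ 2)"
proof -
  define s where "s = real_of_int \<xi> / (1 + (real_of_int \<xi>)\<^sup>2)"
  have "A_mat \<xi> = vector [vector [0, - (\<i> * of_real s)], vector [0, 0]]"
    by (simp add: A_mat_explicit s_def)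
  then have "Re (cinner z (A_mat \<xi> *v z)) = s * Im (cnj (z $ 1) * z $ 2)"
    by (simp add: cinner_def matrix_vector_mult_def sum_2 algebra_simps)
  then show ?thesis
    by (simp add: H1_def s_def)
qed

lemma wnorm_sq_P_bar_eq_H1:
  assumes "\<xi> \<noteq> 0"
  shows "wnorm_sq (P_bar \<xi> (theta \<sigma>)) z = 2 * H1 \<xi> (delta_bar \<xi> \<sigma>) z"
proof -
  have "1 + (real_of_int \<xi>)\<^sup>2 \<noteq> 0"
    by (metis add_nonneg_eq_0_iff one_neq_zero zero_le_one zero_le_power2)
  with assms have "2 * (delta_bar \<xi> \<sigma> * (of_int \<xi> / (1 + (of_int \<xi>)\<^sup>2))) = theta \<sigma> / of_int \<xi>"
    by (simp add: delta_bar_def divide_simps) (simp add: power2_eq_square)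
  then show ?thesis
    unfolding wnorm_sq_P_bar H1_eq by (simp only: distrib_left mult.assoc[symmetric])
qed

text \<open>The constant does not depend on \<open>\<xi>\<close> because a nonzero integer satisfies
  \<open>\<bar>\<xi>\<bar> \<ge> 1\<close>; this uniformity makes the weighted norms summable.\<close>

lemma abs_wnorm_sq_P_bar_le:
  assumes "\<xi> \<noteq> 0"
  shows "\<bar>wnorm_sq (P_bar \<xi> \<theta>) z\<bar> \<le> (1 + \<bar>\<theta>\<bar>) * (norm z)\<^sup>2"
proof -
  have "\<bar>Im (cnj (z $ 1) * z $ 2)\<bar> \<le> cmod (z $ 1) * cmod (z $ 2)"
    using abs_Im_le_cmod[of "cnj (z $ 1) * z $ 2"] by (simp add: norm_mult)
  also have "\<dots> \<le> (norm z)\<^sup>2"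
    using sum_squares_bound[of "cmod (z $ 1)" "cmod (z $ 2)"]
      mult_nonneg_nonneg[of "cmod (z $ 1)" "cmod (z $ 2)"]
    unfolding norm_sq_complex_vec2 by (simp del: mult_nonneg_nonneg)
  finally have cross: "\<bar>Im (cnj (z $ 1) * z $ 2)\<bar> \<le> (norm z)\<^sup>2" .
  have "\<bar>\<theta> / of_int \<xi>\<bar> = \<bar>\<theta>\<bar> / \<bar>of_int \<xi>\<bar>"
    by simp
  also have "\<dots> \<le> \<bar>\<theta>\<bar> / 1"
  proof (rule divide_left_mono)
    show "1 \<le> \<bar>real_of_int \<xi>\<bar>"
      using assms by linarith
  qed (use assms in auto)
  finally have "\<bar>\<theta> / of_int \<xi> * Im (cnj (z $ 1) * z $ 2)\<bar> \<le> \<bar>\<theta>\<bar> * (norm z)\<^sup>2"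
    unfolding abs_mult using cross by (intro mult_mono) auto
  then show ?thesis
    unfolding wnorm_sq_P_bar distrib_right using zero_le_power2[of "norm z"] by linarith
qed

theorem theorem3:
  fixes \<sigma> :: real and y :: "real \<Rightarrow> complex^2"
  assumes "\<sigma> > 0"
    and "\<forall>k::int. \<sigma> \<noteq> 2 * of_int k"
    and "\<forall>j. (\<lambda>x. y x $ j) \<in> L2_torus"
  shows "(\<lambda>\<xi>. H1 \<xi> (delta_bar \<xi> \<sigma>) (fourier_vec y \<xi>)) summable_on (UNIV - {0})
    \<and> (\<lambda>\<xi>. wnorm_sq (P_bar \<xi> (theta \<sigma>)) (fourier_vec y \<xi>)) summable_on (UNIV - {0})
    \<and> H1_tilde \<sigma> y = H2_tilde \<sigma> y"
proof -
  let ?w = "\<lambda>\<xi>. wnorm_sq (P_bar \<xi> (theta \<sigma>)) (fourier_vec y \<xi>)"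
  let ?h = "\<lambda>\<xi>. H1 \<xi> (delta_bar \<xi> \<sigma>) (fourier_vec y \<xi>)"
  have wh: "?w \<xi> = 2 * ?h \<xi>" if "\<xi> \<in> UNIV - {0}" for \<xi>
    using that by (simp add: wnorm_sq_P_bar_eq_H1)
  have "(\<lambda>\<xi>. (1 + \<bar>theta \<sigma>\<bar>) * (norm (fourier_vec y \<xi>))\<^sup>2) summable_on (UNIV - {0})"
    using assms(3) by (intro summable_on_cmult_right fourier_vec_square_summable)
  then have "(\<lambda>\<xi>. norm (?w \<xi>)) summable_on (UNIV - {0})"
    by (rule summable_on_comparison_test) (auto simp: abs_wnorm_sq_P_bar_le)
  then have w: "?w summable_on (UNIV - {0})"
    by (rule abs_summable_summable)
  have "(\<lambda>\<xi>. 1 / 2 * ?w \<xi>) summable_on (UNIV - {0})"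
    using w by (rule summable_on_cmult_right)
  then have h: "?h summable_on (UNIV - {0})"
    by (rule summable_on_cong[THEN iffD1, rotated]) (simp add: wh)
  have "H2_tilde \<sigma> y = (\<Sum>\<^sub>\<infinity>\<xi>\<in>UNIV - {0}. 2 * ?h \<xi>)"
    unfolding H2_tilde_def by (intro infsum_cong wh)
  also have "\<dots> = H1_tilde \<sigma> y"
    unfolding H1_tilde_def by (rule infsum_cmult_right) (use h in auto)
  finally show ?thesis
    using w h by simp
qed

end
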